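(* It is possible to solve the connected components problem in the broadcast congested clique in $O\left(\frac{\log n}{\log\log n}\right)$ rounds.
   Context: Model. $n$ nodes with unique IDs in $[n]=\{1,\dots,n\}$ form a fully connected synchronous network. In each round of the broadcast congested clique every node sends one message of $O(\log n)$ bits, the same to all other nodes; local computation is free. Input. The input is an undirected $n$-node graph $G$ whose nodes are identified with the nodes of the network. Each node initially knows $n$, its own ID and the IDs of its neighbors in $G$. Problem. In the connected components problem, at the end of the execution every node must know a set of edges of $G$ inducing the connected components of $G$. Round complexity is the number of rounds in which an algorithm works on inputs with $n$ nodes. *)

theory Defs
  imports Complex_Main "HOL-Library.Landau_Symbols"
begin

definition simple_graph :: "nat set \<Rightarrow> nat set set \<Rightarrow> bool" where
  "simple_graph V E \<longleftrightarrow> finite V \<and> (\<forall>e\<in>E. e \<subseteq> V \<and> card e = 2)"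

definition neighbors :: "nat set set \<Rightarrow> nat \<Rightarrow> nat set" where
  "neighbors E v = {u. {u, v} \<in> E}"

definition connected_rel :: "nat set \<Rightarrow> nat set set \<Rightarrow> (nat \<times> nat) set" where
  "connected_rel V E = {(u, v). u \<in> V \<and> v \<in> V \<and> (u, v) \<in> {(x, y). {x, y} \<in> E}\<^sup>*}"

definition components :: "nat set \<Rightarrow> nat set set \<Rightarrow> nat set set" where
  "components V E = V // connected_rel V E"

type_synonym message = "bool list"

text \<open>A transcript lists the rounds performed so far in order; the entry of a round is the list of
  the messages broadcast by nodes 1, ..., n, in this order.\<close>

type_synonym transcript = "message list list"

text \<open>A deterministic algorithm, given for all n at once. Since local computation is unrestricted,
  the state of a node is taken to be everything it has seen: n, its own ID, the set of the IDs of its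
  neighbors, and the transcript so far. What it broadcasts in the next round and its final output are
  arbitrary functions of these four arguments. The number of rounds depends on n only.\<close>

record bcc_algorithm =
  rounds :: "nat \<Rightarrow> nat"
  broadcast :: "nat \<Rightarrow> nat \<Rightarrow> nat set \<Rightarrow> transcript \<Rightarrow> message"
  result :: "nat \<Rightarrow> nat \<Rightarrow> nat set \<Rightarrow> transcript \<Rightarrow> nat set set"

primrec run :: "bcc_algorithm \<Rightarrow> nat \<Rightarrow> nat set set \<Rightarrow> nat \<Rightarrow> transcript" where
  "run A n E 0 = []"
| "run A n E (Suc r) =
     run A n E r @ [map (\<lambda>v. broadcast A n v (neighbors E v) (run A n E r)) [1..<Suc n]]"

definition final_transcript :: "bcc_algorithm \<Rightarrow> nat \<Rightarrow> nat set set \<Rightarrow> transcript" where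
  "final_transcript A n E = run A n E (rounds A n)"

definition logarithmic_messages :: "bcc_algorithm \<Rightarrow> bool" where
  "logarithmic_messages A \<longleftrightarrow>
     (\<exists>b :: nat \<Rightarrow> nat. (\<lambda>n. real (b n)) \<in> O(\<lambda>n. log 2 (real n)) \<and>
        (\<forall>n E. simple_graph {1..n} E \<longrightarrow>
           (\<forall>ms \<in> set (final_transcript A n E). \<forall>m \<in> set ms. length m \<le> b n)))"

definition solves_connected_components :: "bcc_algorithm \<Rightarrow> bool" where
  "solves_connected_components A \<longleftrightarrow>
     (\<forall>n E. simple_graph {1..n} E \<longrightarrow>
        (\<exists>F \<subseteq> E. components {1..n} F = components {1..n} E \<and>
           (\<forall>v \<in> {1..n}. result A n v (neighbors E v) (final_transcript A n E) = F)))"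

end

theory Submission
  imports Defs "HOL-Library.FuncSet"
begin

text \<open>Let \<open>q \<approx> root 3 (log n)\<close>. Contracted components carry public labels. A vertex whose neighbourhood meets
  fewer than \<open>q\<^sup>2\<close> labels is dropped and the labelling of that moment is remembered: such a vertex can
  name one neighbour per label in \<open>q\<^sup>2\<close> rounds, and all dropped vertices do so simultaneously at the very
  end, so this cost is paid only once. For each label, one undropped vertex sees at least \<open>q\<^sup>2\<close> labels. A
  random colour class out of \<open>q\<close> contains a \<open>1/q\<close> fraction of the labels and meets all but an \<open>O(1/q)\<close>
  fraction of these neighbourhoods, so merging along one edge into the class divides the number of
  labels by \<open>\<Omega>(q)\<close>. By a counting argument \<open>q\<^sup>8\<close> fixed classes suffice for all neighbourhoods, and
  conditional expectations find a good class deterministically in 8 rounds, since the cost counts for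
  \<open>q\<close> blocks of classes fit into one message. Hence \<open>O(log n / log q)\<close> rounds suffice before
  everything is dropped.\<close>

section \<open>Quantities learnable by broadcasting\<close>

text \<open>This is \<open>run\<close> for a single fixed \<open>n\<close>. Protocols are built for
  each \<open>n\<close> separately, and the final theorem combines them into one
  \<open>bcc_algorithm\<close>.\<close>

primrec transcript_of ::
  "(nat \<Rightarrow> nat set \<Rightarrow> transcript \<Rightarrow> message) \<Rightarrow> nat \<Rightarrow> nat set set \<Rightarrow> nat \<Rightarrow> transcript" where
  "transcript_of bc n E 0 = []"
| "transcript_of bc n E (Suc r) = transcript_of bc n E r @
     [map (\<lambda>v. bc v (neighbors E v) (transcript_of bc n E r)) [1..<Suc n]]"

text \<open>The decoder sees only the transcript, not the input of a particular node, so
  \<open>f E\<close> becomes common knowledge and whatever is computed from it is the same at all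
  nodes. \<open>L\<close> bounds the length of each message, \<open>R\<close> is the number of
  rounds.\<close>

definition learnable :: "nat \<Rightarrow> nat \<Rightarrow> nat \<Rightarrow> (nat set set \<Rightarrow> 'a) \<Rightarrow> bool" where
  "learnable n L R f \<longleftrightarrow> (\<exists>bc dec. \<forall>E. simple_graph {1..n} E \<longrightarrow>
     (\<forall>ms \<in> set (transcript_of bc n E R). \<forall>m \<in> set ms. length m \<le> L) \<and>
     dec (transcript_of bc n E R) = f E)"

lemma length_transcript_of [simp]: "length (transcript_of bc n E r) = r"
  by (induction r) auto

lemma run_eq_transcript_of: "run A n E r = transcript_of (broadcast A n) n E r"
  by (induction r) auto

lemma learnable_const: "learnable n L 0 (\<lambda>_. c)"
  unfolding learnable_def by (intro exI[of _ undefined] exI[of _ "\<lambda>_. c"]) auto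

lemma learnable_map:
  assumes "learnable n L R f" and "\<And>E. simple_graph {1..n} E \<Longrightarrow> f' E = g (f E)"
  shows "learnable n L R f'"
proof -
  obtain bc dec where *: "\<And>E. simple_graph {1..n} E \<Longrightarrow>
     (\<forall>ms \<in> set (transcript_of bc n E R). \<forall>m \<in> set ms. length m \<le> L) \<and>
     dec (transcript_of bc n E R) = f E"
    using assms(1) unfolding learnable_def by blast
  show ?thesis unfolding learnable_def
    by (intro exI[of _ bc] exI[of _ "\<lambda>x. g (dec x)"]) (use * assms(2) in auto)
qed

lemma ex_encoding:
  assumes "finite X" "card X \<le> 2 ^ L"
  obtains enc :: "'b \<Rightarrow> bool list" where "inj_on enc X" "\<And>x. x \<in> X \<Longrightarrow> length (enc x) = L"
proof -
  let ?B = "{xs :: bool list. set xs \<subseteq> UNIV \<and> length xs = L}"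
  have "card ?B = 2 ^ L" using card_lists_length_eq[of "UNIV :: bool set" L] by simp
  moreover have "finite ?B" by (rule finite_lists_length_eq) simp
  ultimately obtain enc where "enc ` X \<subseteq> ?B" "inj_on enc X"
    using card_le_inj[of X ?B] assms by auto
  then show ?thesis using that by blast
qed

text \<open>Appends one round in which every node announces a value computed from the common
  knowledge and its own neighbourhood. As \<open>X\<close> is fixed in advance, a fixed injection
  into bit strings of length \<open>L\<close> lets everyone decode.\<close>

lemma learnable_step:
  fixes g :: "'a \<Rightarrow> nat \<Rightarrow> nat set \<Rightarrow> 'b"
  assumes f: "learnable n L R f"
    and X: "finite X" "card X \<le> 2 ^ L"
    and g: "\<And>E v. simple_graph {1..n} E \<Longrightarrow> v \<in> {1..n} \<Longrightarrow> g (f E) v (neighbors E v) \<in> X"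
  shows "learnable n L (Suc R)
    (\<lambda>E. (f E, \<lambda>v. if v \<in> {1..n} then g (f E) v (neighbors E v) else undefined))"
proof -
  obtain bc dec where *: "\<And>E. simple_graph {1..n} E \<Longrightarrow>
     (\<forall>ms \<in> set (transcript_of bc n E R). \<forall>m \<in> set ms. length m \<le> L) \<and>
     dec (transcript_of bc n E R) = f E"
    using f unfolding learnable_def by blast
  obtain enc :: "'b \<Rightarrow> bool list" where enc: "inj_on enc X" "\<And>x. x \<in> X \<Longrightarrow> length (enc x) = L"
    using ex_encoding[OF X] by blast
  \<comment> \<open>The length of the transcript tells the round: round \<open>R\<close> is the new
    one, and in it every node first decodes \<open>f E\<close>.\<close>
  define bc' where "bc' = (\<lambda>v N (tr::transcript).
    if length tr = R then enc (g (dec tr) v N) else bc v N tr)"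
  have same: "r \<le> R \<Longrightarrow> transcript_of bc' n E r = transcript_of bc n E r" for r E
    by (induction r) (auto simp: bc'_def)
  \<comment> \<open>The message of node \<open>v\<close> stands at index \<open>v - 1\<close>. Off
    the nodes both functions are \<open>undefined\<close>, so that they agree as functions.\<close>
  define dec' where "dec' = (\<lambda>tr. (dec (butlast tr),
    \<lambda>v. if v \<in> {1..n} then the_inv_into X enc (last tr ! (v - 1)) else undefined))"
  show ?thesis unfolding learnable_def
  proof (intro exI[of _ bc'] exI[of _ dec'] allI impI conjI)
    fix E assume E: "simple_graph {1..n} E"
    let ?t = "transcript_of bc n E R"
    let ?ms = "map (\<lambda>v. enc (g (f E) v (neighbors E v))) [1..<Suc n]"
    have tr: "transcript_of bc' n E (Suc R) = ?t @ [?ms]"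
      using *[OF E] by (simp add: same) (simp add: bc'_def)
    show "\<forall>ms\<in>set (transcript_of bc' n E (Suc R)). \<forall>m\<in>set ms. length m \<le> L"
      unfolding tr using *[OF E] enc(2)[OF g[OF E]] by (auto simp: less_Suc_eq_le)
    have "the_inv_into X enc (?ms ! (v - 1)) = g (f E) v (neighbors E v)" if "v \<in> {1..n}" for v
    proof -
      have "[1..<Suc n] ! (v - 1) = v" "v - 1 < length [1..<Suc n]" using that by (auto simp del: upt_Suc)
      then have "?ms ! (v - 1) = enc (g (f E) v (neighbors E v))" by (simp del: upt_Suc)
      then show ?thesis using the_inv_into_f_f[OF enc(1) g[OF E that]] by simp
    qed
    then show "dec' (transcript_of bc' n E (Suc R)) =
      (f E, \<lambda>v. if v \<in> {1..n} then g (f E) v (neighbors E v) else undefined)"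
      unfolding tr dec'_def using *[OF E] by (auto simp del: upt_Suc)
  qed
qed

text \<open>All \<open>k\<close> announcements depend on the initial \<open>f E\<close> alone; the
  values from earlier rounds are merely carried along.\<close>

lemma learnable_steps:
  fixes g :: "'a \<Rightarrow> nat \<Rightarrow> nat set \<Rightarrow> nat \<Rightarrow> 'b"
  assumes f: "learnable n L R f"
    and X: "finite X" "card X \<le> 2 ^ L"
    and g: "\<And>E v i. simple_graph {1..n} E \<Longrightarrow> v \<in> {1..n} \<Longrightarrow> i < k \<Longrightarrow> g (f E) v (neighbors E v) i \<in> X"
  shows "learnable n L (R + k)
    (\<lambda>E. (f E, \<lambda>v i. if v \<in> {1..n} \<and> i < k then g (f E) v (neighbors E v) i else undefined))"
  using g
proof (induction k)
  case 0
  have "learnable n L R (\<lambda>E. (f E, \<lambda>v i. if v \<in> {1..n} \<and> i < (0::nat)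
      then g (f E) v (neighbors E v) i else undefined))"
    by (rule learnable_map[OF f, where g = "\<lambda>a. (a, \<lambda>v i. undefined)"]) (simp add: fun_eq_iff)
  then show ?case by simp
next
  case (Suc k)
  let ?f = "\<lambda>k E. (f E, \<lambda>v i. if v \<in> {1..n} \<and> i < k then g (f E) v (neighbors E v) i else undefined)"
  have IH: "learnable n L (R + k) (?f k)" using Suc by simp
  have "learnable n L (Suc (R + k)) (\<lambda>E. (?f k E,
      \<lambda>v. if v \<in> {1..n} then g (fst (?f k E)) v (neighbors E v) k else undefined))"
    using learnable_step[OF IH X, of "\<lambda>a v N. g (fst a) v N k"] Suc.prems by simp
  then have "learnable n L (Suc (R + k)) (?f (Suc k))"
    by (rule learnable_map[where g = "\<lambda>((a, h), h'). (a, \<lambda>v i.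
          if v \<in> {1..n} \<and> i < Suc k then if i = k then h' v else h v i else undefined)"])
       (auto simp: fun_eq_iff less_Suc_eq)
  then show ?case by simp
qed

section \<open>Averaging and the search for a cheap seed\<close>

lemma ex_le_average:
  fixes G :: "nat \<Rightarrow> nat"
  assumes "q > 0"
  shows "\<exists>d<q. q * G d \<le> (\<Sum>d<q. G d)"
proof (rule ccontr)
  assume "\<not> ?thesis"
  then have "(\<Sum>d<q. G d) < q * G d" if "d < q" for d using that by (meson not_le)
  then have "(\<Sum>d<q. \<Sum>d<q. G d) < (\<Sum>d<q. q * G d)" using assms by (intro sum_strict_mono) auto
  then show False by (simp flip: sum_distrib_left)
qed

text \<open>In base \<open>q\<close>, the seeds with prefix \<open>a\<close> split according to the
  next digit \<open>d\<close>, which extends the prefix to \<open>a * q + d\<close>.\<close>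

lemma sum_split_blocks:
  fixes w :: "nat \<Rightarrow> nat"
  shows "(\<Sum>s<q * m. w (a * (q * m) + s)) = (\<Sum>d<q. \<Sum>s<m. w ((a * q + d) * m + s))"
proof -
  have "(\<Sum>s<q * m. w (a * (q * m) + s)) = (\<Sum>d<q. \<Sum>s\<in>{d * m..<d * m + m}. w (a * (q * m) + s))"
    by (rule sum.nat_group[symmetric])
  also have "\<dots> = (\<Sum>d<q. \<Sum>s<m. w (a * (q * m) + (d * m + s)))"
  proof (rule sum.cong[OF refl])
    fix d
    show "(\<Sum>s\<in>{d * m..<d * m + m}. w (a * (q * m) + s)) = (\<Sum>s<m. w (a * (q * m) + (d * m + s)))"
      using sum.shift_bounds_nat_ivl[of "\<lambda>s. w (a * (q * m) + s)" 0 "d * m" m]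
      by (simp add: lessThan_atLeast0 add.commute add.left_commute)
  qed
  finally show ?thesis by (simp add: algebra_simps)
qed

text \<open>The method of conditional expectations, in base \<open>q\<close>: each round fixes one more digit of the seed,
  every node announcing its share of the cost for each of the \<open>q\<close> values of that digit.\<close>

lemma learnable_cheap_seed:
  fixes n :: nat and p :: "'a \<Rightarrow> nat \<Rightarrow> nat" and c :: "'a \<Rightarrow> nat \<Rightarrow> nat set \<Rightarrow> nat \<Rightarrow> nat"
  defines "w \<equiv> \<lambda>a E s. p a s + (\<Sum>v\<in>{1..n}. c a v (neighbors E v) s)"
  assumes f: "learnable n L R f" and q: "q > 0" and L: "(q ^ j + 1) ^ q \<le> 2 ^ L"
    and c: "\<And>a v N s. c a v N s \<le> 1"
  shows "\<exists>f'. learnable n L (R + j) f' \<and> (\<forall>E. simple_graph {1..n} E \<longrightarrow>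
    fst (f' E) = f E \<and> snd (f' E) < q ^ j \<and>
    q ^ j * w (f E) E (snd (f' E)) \<le> (\<Sum>s<q ^ j. w (f E) E s))"
proof -
  \<comment> \<open>Induction on the number \<open>i\<close> of digits fixed. The seeds with the
    prefix found so far form a block of \<open>q ^ (j - i)\<close> consecutive numbers, and their
    average cost is at most the average over all seeds.\<close>
  have "\<exists>f'. learnable n L (R + i) f' \<and> (\<forall>E. simple_graph {1..n} E \<longrightarrow>
    fst (f' E) = f E \<and> snd (f' E) < q ^ i \<and>
    q ^ i * (\<Sum>s<q ^ (j - i). w (f E) E (snd (f' E) * q ^ (j - i) + s)) \<le> (\<Sum>s<q ^ j. w (f E) E s))"
    if "i \<le> j" for i
    using that
  proof (induction i)
    case 0
    have "learnable n L (R + 0) (\<lambda>E. (f E, 0))"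
      by (simp, rule learnable_map[OF f, where g = "\<lambda>a. (a, 0)"]) simp
    then show ?case by (intro exI[of _ "\<lambda>E. (f E, 0)"]) auto
  next
    case (Suc i)
    define m where "m = q ^ (j - Suc i)"
    have qm: "q ^ (j - i) = q * m" using Suc.prems unfolding m_def by (metis Suc_diff_le diff_Suc_Suc power_Suc)
    obtain f' where f': "learnable n L (R + i) f'"
      and f'E: "\<And>E. simple_graph {1..n} E \<Longrightarrow> fst (f' E) = f E \<and> snd (f' E) < q ^ i \<and>
        q ^ i * (\<Sum>s<q * m. w (f E) E (snd (f' E) * (q * m) + s)) \<le> (\<Sum>s<q ^ j. w (f E) E s)"
      using Suc unfolding qm by auto
    \<comment> \<open>One message holds \<open>q\<close> counts, one for each value of the next
      digit, each at most \<open>q ^ j\<close>; the hypothesis \<open>L\<close> says that they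
      fit.\<close>
    define X where "X = {..<q} \<rightarrow>\<^sub>E {..q ^ j}"
    have X: "finite X" "card X \<le> 2 ^ L"
      unfolding X_def using L by (auto intro: finite_PiE simp: card_PiE)
    define g where "g = (\<lambda>(a, t) v N. \<lambda>d\<in>{..<q}. \<Sum>s<m. c a v N ((t * q + d) * m + s))"
    have mj: "m \<le> q ^ j" unfolding m_def using q by (intro power_increasing) auto
    have "(\<Sum>s<m. c a v N (h s)) \<le> q ^ j" for a v N and h :: "nat \<Rightarrow> nat"
      using sum_bounded_above[of "{..<m}" "\<lambda>s. c a v N (h s)" 1] c mj by auto
    then have gX: "g z v N \<in> X" for z v N by (cases z) (auto simp: g_def X_def)
    have step: "learnable n L (Suc (R + i))
      (\<lambda>E. (f' E, \<lambda>v. if v \<in> {1..n} then g (f' E) v (neighbors E v) else undefined))"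
      by (rule learnable_step[OF f' X]) (rule gX)
    \<comment> \<open>The share \<open>p\<close> depends on public data only and is added locally;
      just the shares \<open>c\<close> have to be announced.\<close>
    define G where "G = (\<lambda>a t h d. (\<Sum>s<m. p a ((t * q + d) * m + s)) + (\<Sum>v\<in>{1..n}. (h :: nat \<Rightarrow> nat \<Rightarrow> nat) v d))"
    \<comment> \<open>A fixed choice function of public data, so all nodes select the same
      digit.\<close>
    define D where "D = (\<lambda>a t h. SOME d. d < q \<and> q * G a t h d \<le> (\<Sum>d<q. G a t h d))"
    have D: "D a t h < q \<and> q * G a t h (D a t h) \<le> (\<Sum>d<q. G a t h d)" for a t h
      unfolding D_def by (rule someI_ex) (use ex_le_average[OF q] in blast)
    define u where "u = (\<lambda>((a, t), h). (a, t * q + D a t h))"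
    let ?f = "\<lambda>E. u (f' E, \<lambda>v. if v \<in> {1..n} then g (f' E) v (neighbors E v) else undefined)"
    have "learnable n L (R + Suc i) ?f"
      by (simp, rule learnable_map[OF step, where g = u]) simp
    moreover have "fst (?f E) = f E \<and> snd (?f E) < q ^ Suc i \<and>
        q ^ Suc i * (\<Sum>s<m. w (f E) E (snd (?f E) * m + s)) \<le> (\<Sum>s<q ^ j. w (f E) E s)"
      if E: "simple_graph {1..n} E" for E
    proof -
      obtain t where t: "f' E = (f E, t)" using f'E[OF E] by (metis prod.collapse)
      have tq: "t < q ^ i" using f'E[OF E] t by simp
      let ?h = "\<lambda>v. if v \<in> {1..n} then g (f E, t) v (neighbors E v) else undefined"
      let ?D = "D (f E) t ?h"
      have fE: "?f E = (f E, t * q + ?D)" by (simp add: u_def t cong: if_cong)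
      have G: "G (f E) t ?h d = (\<Sum>s<m. w (f E) E ((t * q + d) * m + s))" if "d < q" for d
      proof -
        have "(\<Sum>v\<in>{1..n}. ?h v d) = (\<Sum>v\<in>{1..n}. \<Sum>s<m. c (f E) v (neighbors E v) ((t * q + d) * m + s))"
          using that by (intro sum.cong) (auto simp: g_def)
        also have "\<dots> = (\<Sum>s<m. \<Sum>v\<in>{1..n}. c (f E) v (neighbors E v) ((t * q + d) * m + s))"
          by (rule sum.swap)
        finally show ?thesis unfolding G_def w_def by (simp add: sum.distrib)
      qed
      have "t * q + ?D < Suc t * q" using D[of "f E" t ?h] by simp
      also have "\<dots> \<le> q ^ i * q" using tq by (intro mult_right_mono) auto
      finally have lt: "t * q + ?D < q ^ Suc i" by (simp add: mult.commute)
      have "q * (\<Sum>s<m. w (f E) E ((t * q + ?D) * m + s)) = q * G (f E) t ?h ?D"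
        by (simp only: G[OF conjunct1[OF D[of "f E" t ?h]]])
      also have "\<dots> \<le> (\<Sum>d<q. G (f E) t ?h d)" using D by blast
      also have "\<dots> = (\<Sum>s<q * m. w (f E) E (t * (q * m) + s))"
        unfolding sum_split_blocks by (rule sum.cong[OF refl], rule G) simp
      finally have "q ^ i * (q * (\<Sum>s<m. w (f E) E ((t * q + ?D) * m + s))) \<le>
          q ^ i * (\<Sum>s<q * m. w (f E) E (t * (q * m) + s))" by (rule mult_left_mono) simp
      also have "\<dots> \<le> (\<Sum>s<q ^ j. w (f E) E s)" using f'E[OF E] t by simp
      finally show ?thesis unfolding fE using lt by (simp add: mult_ac)
    qed
    ultimately show ?case unfolding m_def[symmetric] by (intro exI[of _ ?f]) blast
  qed
  from this[of j] show ?thesis by simp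
qed

section \<open>Colour classes hitting all large sets\<close>

text \<open>The coordinates \<open>(i, x)\<close> are independent. For \<open>x\<close> in
  \<open>N\<close>, the \<open>r\<close> colours that \<open>I\<close> has in row \<open>i\<close>
  are forbidden, which leaves a fraction \<open>1 - r / q \<le> exp (- r / q)\<close> of the
  colours. The exponents add up to \<open>card N * card I / q\<close>.\<close>

lemma card_avoiding_colourings:
  fixes V :: "'v set"
  assumes "finite V" "N \<subseteq> V" "I \<subseteq> {..<T} \<times> {..<q}" "q > 0"
  shows "real (card {h \<in> ({..<T} \<times> V) \<rightarrow>\<^sub>E {..<q}. \<forall>(i, c)\<in>I. \<forall>x\<in>N. h (i, x) \<noteq> c})
    \<le> real q ^ (T * card V) * exp (- real (card N * card I) / q)"
proof -
  let ?I = "\<lambda>i. I `` {i}"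
  let ?F = "\<lambda>(i, x). {..<q} - (if x \<in> N then ?I i else {})"
  let ?u = "\<lambda>(i, x). if x \<in> N then real (card (?I i)) / q else 0"
  have fI: "finite (?I i)" "?I i \<subseteq> {..<q}" for i
    using assms(3) by (auto intro: finite_subset[of _ "{..<q}"])
  have fN: "finite N" using assms by (auto intro: finite_subset)
  have "I = Sigma {..<T} ?I" using assms(3) by auto
  then have cI: "card I = (\<Sum>i<T. card (?I i))"
    using card_SigmaI[of "{..<T}" ?I] fI by simp
  have "{h \<in> ({..<T} \<times> V) \<rightarrow>\<^sub>E {..<q}. \<forall>(i, c)\<in>I. \<forall>x\<in>N. h (i, x) \<noteq> c} \<subseteq> Pi\<^sub>E ({..<T} \<times> V) ?F"
  proof
    fix h assume "h \<in> {h \<in> ({..<T} \<times> V) \<rightarrow>\<^sub>E {..<q}. \<forall>(i, c)\<in>I. \<forall>x\<in>N. h (i, x) \<noteq> c}"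
    then have h: "h \<in> ({..<T} \<times> V) \<rightarrow>\<^sub>E {..<q}"
      "\<And>i x. x \<in> N \<Longrightarrow> (i, h (i, x)) \<notin> I" by auto
    show "h \<in> Pi\<^sub>E ({..<T} \<times> V) ?F"
    proof (rule PiE_I)
      fix z assume "z \<in> {..<T} \<times> V"
      then have "h z < q" using h(1) by auto
      then show "h z \<in> ?F z" using h(2) by (cases z) auto
    qed (rule PiE_arb[OF h(1)])
  qed
  then have "card {h \<in> ({..<T} \<times> V) \<rightarrow>\<^sub>E {..<q}. \<forall>(i, c)\<in>I. \<forall>x\<in>N. h (i, x) \<noteq> c}
      \<le> card (Pi\<^sub>E ({..<T} \<times> V) ?F)"
    using assms(1) by (intro card_mono finite_PiE) auto
  also have "\<dots> = (\<Prod>z\<in>{..<T} \<times> V. card (?F z))"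
    using assms(1) by (intro card_PiE) auto
  finally have "real (card {h \<in> ({..<T} \<times> V) \<rightarrow>\<^sub>E {..<q}. \<forall>(i, c)\<in>I. \<forall>x\<in>N. h (i, x) \<noteq> c})
      \<le> real (\<Prod>z\<in>{..<T} \<times> V. card (?F z))"
    by (rule of_nat_mono)
  also have "\<dots> = (\<Prod>z\<in>{..<T} \<times> V. real (card (?F z)))" by (rule of_nat_prod)
  also have "\<dots> \<le> (\<Prod>z\<in>{..<T} \<times> V. real q * exp (- ?u z))"
  proof (intro prod_mono conjI)
    fix z assume "z \<in> {..<T} \<times> V"
    obtain i x where z: "z = (i, x)" by force
    have le: "card (?I i) \<le> q" using card_mono[OF _ fI(2)] by auto
    have "real q - card (?I i) = q * (1 + - (real (card (?I i)) / q))"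
      using assms(4) by (simp add: field_simps)
    also have "\<dots> \<le> q * exp (- (real (card (?I i)) / q))"
      by (intro mult_left_mono exp_ge_add_one_self) auto
    finally show "real (card (?F z)) \<le> real q * exp (- ?u z)"
      unfolding z using fI le by (auto simp: card_Diff_subset of_nat_diff)
  qed auto
  also have "\<dots> = real q ^ (T * card V) * exp (- (\<Sum>z\<in>{..<T} \<times> V. ?u z))"
    using assms(1) by (simp add: prod.distrib exp_sum card_cartesian_product flip: sum_negf)
  also have "(\<Sum>z\<in>{..<T} \<times> V. ?u z) = (\<Sum>i<T. \<Sum>x\<in>V. if x \<in> N then real (card (?I i)) / q else 0)"
    by (simp add: sum.cartesian_product)
  also have "\<dots> = (\<Sum>i<T. card N * (real (card (?I i)) / q))"
    using assms(1,2) by (simp add: sum.If_cases Int_absorb1)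
  also have "\<dots> = real (card N * card I) / q"
    by (simp add: cI sum_distrib_left sum_divide_distrib)
  finally show ?thesis by simp
qed

text \<open>Union bound over the \<open>k\<close>-element sets \<open>N\<close> and the sets
  \<open>I\<close> of at least \<open>m\<close> colour classes avoided by \<open>N\<close>: by
  hypothesis \<open>T\<close>, the bad choices of \<open>h\<close> are fewer than all
  choices.\<close>

lemma ex_good_colouring:
  assumes q: "q \<ge> 1" and T: "n ^ k * 2 ^ (T * q) * q ^ (T * n) < 2 ^ (k * m div q) * q ^ (T * n)"
    and V: "finite V" "card V = n"
  obtains h :: "nat \<times> 'v \<Rightarrow> nat" where "\<And>i x. i < T \<Longrightarrow> x \<in> V \<Longrightarrow> h (i, x) < q"
    "\<And>N. N \<subseteq> V \<Longrightarrow> k \<le> card N \<Longrightarrow>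
       card {(i, c). i < T \<and> c < q \<and> c \<notin> (\<lambda>x. h (i, x)) ` N} < m"
proof -
  let ?P = "({..<T} \<times> V) \<rightarrow>\<^sub>E {..<q}"
  let ?Ns = "{N. N \<subseteq> V \<and> card N = k}"
  let ?Is = "{I. I \<subseteq> {..<T} \<times> {..<q} \<and> m \<le> card I}"
  define bad where "bad = (\<lambda>(N, I). {h \<in> ?P. \<forall>(i, c)\<in>I. \<forall>x\<in>N. h (i, x) \<noteq> c})"
  have fP: "finite ?P" using V by (intro finite_PiE) auto
  have fN: "finite ?Ns" by (rule finite_subset[of _ "Pow V"]) (use V in auto)
  have fI: "finite ?Is" by (rule finite_subset[of _ "Pow ({..<T} \<times> {..<q})"]) auto
  have cP: "card ?P = q ^ (T * n)" using V by (simp add: card_PiE card_cartesian_product)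
  have cN: "card ?Ns \<le> n ^ k"
    using n_subsets[OF V(1), of k] V(2) binomial_le_pow[of k n] 
    by (cases "k \<le> n") (auto simp: binomial_eq_0)
  have "card ?Is \<le> card (Pow ({..<T} \<times> {..<q}))" by (intro card_mono) auto
  then have cI: "card ?Is \<le> 2 ^ (T * q)" by (simp add: card_Pow card_cartesian_product)
  have bound: "real (card (bad z)) \<le> q ^ (T * n) / 2 ^ (k * m div q)" if "z \<in> ?Ns \<times> ?Is" for z
  proof -
    obtain N I where z: "z = (N, I)" by force
    have NI: "N \<subseteq> V" "card N = k" "I \<subseteq> {..<T} \<times> {..<q}" "m \<le> card I" using that z by auto
    have "real (k * m div q) \<le> real (k * m) / q" by (rule of_nat_div_le_of_nat)
    also have "\<dots> \<le> real (card N * card I) / q"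
      using NI q by (intro divide_right_mono of_nat_mono mult_mono) auto
    finally have "exp (- real (card N * card I) / q) \<le> exp (- real (k * m div q))" by simp
    also have "\<dots> = (1 / exp 1) ^ (k * m div q)"
      by (simp add: exp_minus power_one_over inverse_eq_divide flip: exp_of_nat_mult)
    \<comment> \<open>Replacing \<open>exp 1\<close> by the smaller 2 allows \<open>T\<close> to be
      stated in natural numbers.\<close>
    also have "\<dots> \<le> (1 / 2) ^ (k * m div q)"
      using exp_ge_add_one_self[of 1] by (intro power_mono divide_left_mono) auto
    finally have e: "exp (- real (card N * card I) / q) \<le> 1 / 2 ^ (k * m div q)"
      by (simp add: power_one_over)
    have "real (card (bad z)) \<le> real q ^ (T * card V) * exp (- real (card N * card I) / q)"
      using card_avoiding_colourings[OF V(1) NI(1,3)] q unfolding z bad_def by simp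
    also have "\<dots> \<le> real q ^ (T * card V) * (1 / 2 ^ (k * m div q))"
      by (intro mult_left_mono e) auto
    finally show ?thesis using V by simp
  qed
  have "real (card (\<Union>z\<in>?Ns \<times> ?Is. bad z)) \<le> real (\<Sum>z\<in>?Ns \<times> ?Is. card (bad z))"
    using fN fI by (intro of_nat_mono card_UN_le) auto
  also have "\<dots> = (\<Sum>z\<in>?Ns \<times> ?Is. real (card (bad z)))" by simp
  also have "\<dots> \<le> (\<Sum>z\<in>?Ns \<times> ?Is. q ^ (T * n) / 2 ^ (k * m div q))"
    by (intro sum_mono bound)
  also have "\<dots> = real (card ?Ns * card ?Is) * (q ^ (T * n) / 2 ^ (k * m div q))"
    by (simp add: card_cartesian_product)
  also have "\<dots> \<le> real (n ^ k * 2 ^ (T * q)) * (q ^ (T * n) / 2 ^ (k * m div q))"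
    by (intro mult_right_mono of_nat_mono mult_mono cN cI) auto
  also have "\<dots> = real (n ^ k * 2 ^ (T * q) * q ^ (T * n)) / 2 ^ (k * m div q)" by simp
  also have "\<dots> < real (2 ^ (k * m div q) * q ^ (T * n)) / 2 ^ (k * m div q)"
    by (intro divide_strict_right_mono) (use T in \<open>simp only: of_nat_less_iff\<close>, simp)
  also have "\<dots> = card ?P" by (simp add: cP)
  finally have "card (\<Union>z\<in>?Ns \<times> ?Is. bad z) < card ?P" by simp
  moreover have "finite (\<Union>z\<in>?Ns \<times> ?Is. bad z)" 
    using fN fI by (intro finite_UN_I finite_SigmaI finite_subset[OF _ fP]) (auto simp: bad_def)
  ultimately have "\<not> ?P \<subseteq> (\<Union>z\<in>?Ns \<times> ?Is. bad z)" by (meson card_mono leD)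
  then obtain h where h: "h \<in> ?P" "\<And>z. z \<in> ?Ns \<times> ?Is \<Longrightarrow> h \<notin> bad z" by blast
  show thesis
  proof (rule that[of h])
    show "h (i, x) < q" if "i < T" "x \<in> V" for i x using h(1) that by (auto simp: PiE_iff)
    fix N assume N: "N \<subseteq> V" "k \<le> card N"
    \<comment> \<open>A larger set misses fewer classes, so a subset of size exactly
      \<open>k\<close> suffices.\<close>
    obtain N' where N': "N' \<subseteq> N" "card N' = k" using N(2) obtain_subset_with_card_n by metis
    let ?J = "\<lambda>N. {(i, c). i < T \<and> c < q \<and> c \<notin> (\<lambda>x. h (i, x)) ` N}"
    have fin: "finite (?J N)" for N by (rule finite_subset[of _ "{..<T} \<times> {..<q}"]) auto
    have "?J N' \<notin> ?Is"
    proof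
      assume "?J N' \<in> ?Is"
      then have "h \<notin> bad (N', ?J N')" using N N' by (intro h(2)) auto
      then show False using h(1) by (force simp: bad_def)
    qed
    then have "card (?J N') < m" by auto
    moreover have "card (?J N) \<le> card (?J N')" using N' by (intro card_mono fin) auto
    ultimately show "card (?J N) < m" by simp
  qed
qed

text \<open>Take \<open>q ^ 7\<close> colourings with \<open>q\<close> colours; class
  \<open>s\<close> belongs to colouring \<open>s div q\<close> and colour \<open>s mod q\<close>. A
  point lies in one class of each colouring. The union bound works with
  \<open>m = 2 * q ^ 7 + 1\<close>: the numbers of sets \<open>N\<close> and of sets
  \<open>I\<close> are each at most \<open>2 ^ (q ^ 8)\<close>, while the exponent gained is
  \<open>2 * q ^ 8 + q\<close>.\<close>

lemma ex_hitting_family: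
  assumes q: "q \<ge> 2" and n: "n < 2 ^ ((q + 1) ^ 3)"
  obtains S :: "nat \<Rightarrow> nat set" where
    "\<And>x. x \<in> {1..n} \<Longrightarrow> card {s. s < q ^ 8 \<and> x \<in> S s} \<le> q ^ 7"
    "\<And>N. N \<subseteq> {1..n} \<Longrightarrow> q\<^sup>2 \<le> card N \<Longrightarrow> card {s. s < q ^ 8 \<and> S s \<inter> N = {}} \<le> 2 * q ^ 7"
proof -
  have "2 * q \<le> q * q" using q by simp
  then have "q + 1 \<le> q\<^sup>2" using q unfolding power2_eq_square by linarith
  then have "(q + 1) ^ 3 \<le> (q\<^sup>2) ^ 3" by (rule power_mono) simp
  also have "\<dots> = q ^ 6" by (simp flip: power_mult)
  finally have "(q + 1) ^ 3 * q\<^sup>2 \<le> q ^ 6 * q\<^sup>2" by (rule mult_right_mono) simp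
  also have "\<dots> = q ^ 8" by (simp flip: power_add)
  finally have le: "(q + 1) ^ 3 * q\<^sup>2 \<le> q ^ 8" .
  have q8: "q ^ 7 * q = q ^ 8" "q * q ^ 7 = q ^ 8" by (simp_all flip: power_Suc power_Suc2)
  have "q\<^sup>2 * (2 * q ^ 7 + 1) div q = q * (2 * q ^ 7 + 1)"
    using q by (simp add: power2_eq_square mult.assoc)
  then have e: "q\<^sup>2 * (2 * q ^ 7 + 1) div q = q ^ 8 + q ^ 8 + q"
    unfolding distrib_left mult.left_commute[of q 2] q8 by simp
  have "n ^ q\<^sup>2 \<le> (2 ^ ((q + 1) ^ 3)) ^ q\<^sup>2" using n by (intro power_mono) auto
  also have "\<dots> = 2 ^ ((q + 1) ^ 3 * q\<^sup>2)" by (simp only: power_mult)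
  also have "\<dots> \<le> 2 ^ (q ^ 8)" using le by (rule power_increasing) simp
  finally have "n ^ q\<^sup>2 * 2 ^ (q ^ 7 * q) \<le> 2 ^ (q ^ 8) * 2 ^ (q ^ 8)"
    unfolding q8 by (rule mult_right_mono) simp
  also have "\<dots> = 2 ^ (q ^ 8 + q ^ 8)" by (simp only: power_add)
  also have "\<dots> < 2 ^ (q ^ 8 + q ^ 8 + q)"
    using q by (intro power_strict_increasing) auto
  finally have "n ^ q\<^sup>2 * 2 ^ (q ^ 7 * q) < 2 ^ (q\<^sup>2 * (2 * q ^ 7 + 1) div q)" unfolding e .
  then have T: "n ^ q\<^sup>2 * 2 ^ (q ^ 7 * q) * q ^ (q ^ 7 * n) < 2 ^ (q\<^sup>2 * (2 * q ^ 7 + 1) div q) * q ^ (q ^ 7 * n)"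
    by (rule mult_strict_right_mono) (use q in simp)
  obtain h :: "nat \<times> nat \<Rightarrow> nat" where
    h: "\<And>i x. i < q ^ 7 \<Longrightarrow> x \<in> {1..n} \<Longrightarrow> h (i, x) < q"
    "\<And>N. N \<subseteq> {1..n} \<Longrightarrow> q\<^sup>2 \<le> card N \<Longrightarrow>
       card {(i, c). i < q ^ 7 \<and> c < q \<and> c \<notin> (\<lambda>x. h (i, x)) ` N} < 2 * q ^ 7 + 1"
    by (rule ex_good_colouring[OF _ T, of "{1..n}"]) (use q in auto)
  define S where "S s = {x. h (s div q, x) = s mod q}" for s
  have div: "s div q < q ^ 7" if "s < q ^ 8" for s
    using that by (simp add: less_mult_imp_div_less q8)
  show thesis
  proof (rule that[of S])
    fix x assume "x \<in> {1..n}"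
    have "inj_on (\<lambda>s. s div q) {s. s < q ^ 8 \<and> x \<in> S s}"
      by (rule inj_onI) (metis (mono_tags, lifting) S_def div_mult_mod_eq mem_Collect_eq)
    then have "card {s. s < q ^ 8 \<and> x \<in> S s} \<le> card {..<q ^ 7}"
      by (rule card_inj_on_le) (auto simp: div)
    then show "card {s. s < q ^ 8 \<and> x \<in> S s} \<le> q ^ 7" by simp
  next
    fix N assume N: "N \<subseteq> {1..n}" "q\<^sup>2 \<le> card N"
    let ?J = "{(i, c). i < q ^ 7 \<and> c < q \<and> c \<notin> (\<lambda>x. h (i, x)) ` N}"
    have "inj_on (\<lambda>s. (s div q, s mod q)) {s. s < q ^ 8 \<and> S s \<inter> N = {}}"
      by (rule inj_onI) (metis div_mult_mod_eq prod.inject)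
    moreover have "(\<lambda>s. (s div q, s mod q)) ` {s. s < q ^ 8 \<and> S s \<inter> N = {}} \<subseteq> ?J"
      using q by (auto simp: div S_def)
    moreover have "finite ?J" by (rule finite_subset[of _ "{..<q ^ 7} \<times> {..<q}"]) auto
    ultimately have "card {s. s < q ^ 8 \<and> S s \<inter> N = {}} \<le> card ?J" by (rule card_inj_on_le)
    then show "card {s. s < q ^ 8 \<and> S s \<inter> N = {}} \<le> 2 * q ^ 7" using h(2)[OF N] by linarith
  qed
qed

section \<open>Merging components\<close>

definition conn :: "nat set set \<Rightarrow> (nat \<times> nat) set" where
  "conn K = {(x, y). {x, y} \<in> K}\<^sup>*"

definition seen :: "nat set \<Rightarrow> (nat \<Rightarrow> nat option) \<Rightarrow> nat set" where
  "seen N l = {a. \<exists>u\<in>N. l u = Some a}"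

text \<open>Vertices without a label must not be identified by \<open>None\<close>, hence the
  restriction to \<open>dom l\<close>. The converse is not demanded: connected vertices may carry
  different labels.\<close>

definition consistent :: "nat set set \<Rightarrow> (nat \<Rightarrow> nat option) \<Rightarrow> bool" where
  "consistent K l \<longleftrightarrow> (\<forall>x y. x \<in> dom l \<longrightarrow> l x = l y \<longrightarrow> (x, y) \<in> conn K)"

lemma conn_refl: "(x, x) \<in> conn K"
  by (simp add: conn_def)

lemma conn_sym: "(x, y) \<in> conn K \<Longrightarrow> (y, x) \<in> conn K"
  unfolding conn_def by (rule symD[OF sym_rtrancl]) (auto simp: sym_def insert_commute)

lemma conn_trans: "(x, y) \<in> conn K \<Longrightarrow> (y, z) \<in> conn K \<Longrightarrow> (x, z) \<in> conn K"
  unfolding conn_def by (rule rtrancl_trans)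

lemma conn_edge: "{x, y} \<in> K \<Longrightarrow> (x, y) \<in> conn K"
  unfolding conn_def by blast

lemma conn_mono: "K \<subseteq> K' \<Longrightarrow> conn K \<subseteq> conn K'"
  unfolding conn_def by (rule rtrancl_mono) auto

lemma consistent_mono: "K \<subseteq> K' \<Longrightarrow> consistent K l \<Longrightarrow> consistent K' l"
  unfolding consistent_def using conn_mono by blast

lemma components_eqI:
  assumes "F \<subseteq> E" and "\<And>u v. {u, v} \<in> E \<Longrightarrow> (u, v) \<in> conn F"
  shows "components V F = components V E"
proof -
  have "conn E \<subseteq> (conn F)\<^sup>*" unfolding conn_def[of E] using assms(2) by (intro rtrancl_mono) auto
  then have "conn E = conn F" using conn_mono[OF assms(1)] by (auto simp: conn_def)
  then show ?thesis by (simp add: components_def connected_rel_def conn_def)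
qed

lemma neighbors_subset: "simple_graph {1..n} E \<Longrightarrow> neighbors E v \<subseteq> {1..n}"
  by (auto simp: simple_graph_def neighbors_def)

lemma edge_subset: "simple_graph {1..n} E \<Longrightarrow> {u, v} \<in> E \<Longrightarrow> u \<in> {1..n} \<and> v \<in> {1..n}"
  by (auto simp: simple_graph_def)

lemma seen_subset: "ran l \<subseteq> A \<Longrightarrow> seen N l \<subseteq> A"
  by (auto simp: seen_def ran_def)

record state =
  labels :: "nat \<Rightarrow> nat option"
  snapshot :: "nat \<Rightarrow> nat \<Rightarrow> nat option"
  known :: "nat set set"

text \<open>The vertices in the domain of \<open>labels\<close> are the active ones. A vertex \<open>v\<close> is dropped once it sees
  fewer than \<open>q\<^sup>2\<close> labels, and \<open>snapshot\<close> then remembers the labelling at that time. Every edge is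
  within reach of the snapshot of the endpoint that was dropped first.\<close>

definition invariant :: "nat \<Rightarrow> nat \<Rightarrow> nat \<Rightarrow> nat set set \<Rightarrow> state \<Rightarrow> bool" where
  "invariant n q t E s \<longleftrightarrow>
     known s \<subseteq> E \<and> dom (labels s) \<subseteq> {1..n} \<and> ran (labels s) \<subseteq> {1..n} \<and>
     consistent (known s) (labels s) \<and>
     (\<forall>v \<in> {1..n} - dom (labels s). consistent (known s) (snapshot s v) \<and>
        ran (snapshot s v) \<subseteq> {1..n} \<and> card (seen (neighbors E v) (snapshot s v)) < q\<^sup>2) \<and>
     (\<forall>u v. {u, v} \<in> E \<longrightarrow>
        u \<in> dom (labels s) \<and> v \<in> dom (labels s) \<or>
        v \<notin> dom (labels s) \<and> u \<in> dom (snapshot s v) \<or>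
        u \<notin> dom (labels s) \<and> v \<in> dom (snapshot s u)) \<and>
     card (ran (labels s)) * q ^ t \<le> n * 3 ^ t"

definition heavy :: "nat \<Rightarrow> nat set set \<Rightarrow> state \<Rightarrow> nat set" where
  "heavy q E s = {v \<in> dom (labels s). q\<^sup>2 \<le> card (seen (neighbors E v) (labels s))}"

text \<open>In use \<open>H\<close> is the set of heavy vertices, and one of them decides on behalf
  of its label. If no heavy vertex carries a label, all vertices carrying it are dropped.\<close>

definition rep :: "state \<Rightarrow> nat set \<Rightarrow> nat \<Rightarrow> nat" where
  "rep s H x = (LEAST v. v \<in> H \<and> labels s v = labels s x)"

text \<open>The value \<open>0\<close>, which is not a vertex, encodes that a vertex has no pointer.\<close>

definition merge :: "nat \<Rightarrow> state \<Rightarrow> nat set \<Rightarrow> (nat \<Rightarrow> nat) \<Rightarrow> state" where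
  "merge n s H ptr =
     \<lparr>labels = (\<lambda>x. if x \<in> H then let v = rep s H x in labels s (if ptr v = 0 then v else ptr v) else None),
      snapshot = (\<lambda>v. if v \<in> dom (labels s) - H then labels s else snapshot s v),
      known = known s \<union> {{v, ptr v} |v. v \<in> {1..n} \<and> ptr v \<noteq> 0}\<rparr>"

lemma rep:
  assumes "x \<in> H"
  shows "rep s H x \<in> H" "labels s (rep s H x) = labels s x" "rep s H (rep s H x) = rep s H x"
proof -
  have "rep s H x \<in> H \<and> labels s (rep s H x) = labels s x"
    unfolding rep_def by (rule LeastI[of _ x]) (use assms in simp)
  then show "rep s H x \<in> H" "labels s (rep s H x) = labels s x" by auto
  then show "rep s H (rep s H x) = rep s H x" by (simp add: rep_def)
qed

lemma rep_cong: "labels s x = labels s y \<Longrightarrow> rep s H x = rep s H y"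
  by (simp add: rep_def)

text \<open>Every label follows a single pointer and takes over the old label of the target.
  Pointers are not composed, so chains and cycles do no harm: equal new labels lead to targets with
  equal old labels, which were connected before. A new label lies in \<open>B\<close> or is the old
  label of a representative that sees nothing of \<open>B\<close>, so by \<open>cost\<close> at most
  a fraction \<open>3 / q\<close> of the labels remains.\<close>

lemma invariant_merge:
  assumes E: "simple_graph {1..n} E" and inv: "invariant n q t E s"
    and H: "H = heavy q E s"
    and ptr: "\<And>v. v \<in> {1..n} \<Longrightarrow> ptr v \<noteq> 0 \<Longrightarrow> ptr v \<in> neighbors E v \<and> (\<exists>b\<in>B. labels s (ptr v) = Some b)"
    and ptr0: "\<And>v. v \<in> H \<Longrightarrow> rep s H v = v \<Longrightarrow> ptr v = 0 \<Longrightarrow> seen (neighbors E v) (labels s) \<inter> B = {}"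
    and cost: "q * (card (ran (labels s) \<inter> B) +
      card {v \<in> H. rep s H v = v \<and> seen (neighbors E v) (labels s) \<inter> B = {}}) \<le> 3 * card (ran (labels s))"
  shows "invariant n q (Suc t) E (merge n s H ptr)"
proof -
  let ?l = "labels s" and ?s = "merge n s H ptr"
  \<comment> \<open>\<open>\<rho> x\<close> is the vertex whose old label \<open>x\<close>
    receives.\<close>
  define \<rho> where "\<rho> x = (let v = rep s H x in if ptr v = 0 then v else ptr v)" for x
  have l': "labels ?s x = (if x \<in> H then ?l (\<rho> x) else None)" for x
    by (simp add: merge_def \<rho>_def Let_def)
  have HV: "H \<subseteq> dom ?l" "H \<subseteq> {1..n}" "dom ?l \<subseteq> {1..n}" "ran ?l \<subseteq> {1..n}"
    using inv unfolding invariant_def H heavy_def by auto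
  have K: "known s \<subseteq> known ?s" by (auto simp: merge_def)
  have \<rho>l: "\<rho> x \<in> dom ?l" if "x \<in> H" for x
    using subsetD[OF HV(1) rep(1)[OF that, of s]] ptr[OF subsetD[OF HV(2) rep(1)[OF that, of s]]]
    by (auto simp: \<rho>_def Let_def)
  have dom': "dom (labels ?s) = H" 
  proof (rule set_eqI)
    show "x \<in> dom (labels ?s) \<longleftrightarrow> x \<in> H" for x
      using \<rho>l[of x] by (cases "x \<in> H") (simp_all add: l' dom_def)
  qed
  have cons: "consistent (known s) ?l" using inv by (simp add: invariant_def)
  have K': "{v, ptr v} \<in> known ?s" if "v \<in> {1..n}" "ptr v \<noteq> 0" for v
    using that by (auto simp: merge_def)
  have conn\<rho>: "(x, \<rho> x) \<in> conn (known ?s)" if x: "x \<in> H" for x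
  proof -
    note r = rep[OF x, of s]
    have "(x, rep s H x) \<in> conn (known s)" using cons x HV r(2) unfolding consistent_def by force
    then have 1: "(x, rep s H x) \<in> conn (known ?s)" using conn_mono[OF K] by blast
    show ?thesis
    proof (cases "ptr (rep s H x) = 0")
      case True
      then show ?thesis using 1 by (simp add: \<rho>_def)
    next
      case False
      then have "(rep s H x, \<rho> x) \<in> conn (known ?s)"
        using conn_edge[OF K'[OF subsetD[OF HV(2) r(1)] False]] by (simp add: \<rho>_def)
      then show ?thesis using 1 conn_trans by blast
    qed
  qed
  have "consistent (known ?s) (labels ?s)"
    unfolding consistent_def dom'
  proof (intro allI impI)
    fix x y assume x: "x \<in> H" and xy: "labels ?s x = labels ?s y"
    have "labels ?s x \<noteq> None" using x dom' by blast
    then have y: "y \<in> H" using xy dom' by auto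
    have "?l (\<rho> x) = ?l (\<rho> y)" using xy x y by (simp add: l')
    then have "(\<rho> x, \<rho> y) \<in> conn (known s)" using cons \<rho>l[OF x] unfolding consistent_def by blast
    then have "(\<rho> x, \<rho> y) \<in> conn (known ?s)" using conn_mono[OF K] by blast
    then show "(x, y) \<in> conn (known ?s)"
      using conn\<rho>[OF x] conn_sym[OF conn\<rho>[OF y]] conn_trans by blast
  qed
  moreover have "known ?s \<subseteq> E"
  proof -
    have "{v, ptr v} \<in> E" if "v \<in> {1..n}" "ptr v \<noteq> 0" for v
      using ptr[OF that] by (simp add: neighbors_def insert_commute)
    then show ?thesis using inv by (auto simp: merge_def invariant_def)
  qed
  moreover have "ran (labels ?s) \<subseteq> ran ?l" using HV by (auto simp: ran_def l' split: if_splits)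
  moreover have "consistent (known ?s) (snapshot ?s v) \<and> ran (snapshot ?s v) \<subseteq> {1..n} \<and>
      card (seen (neighbors E v) (snapshot ?s v)) < q\<^sup>2" if v: "v \<in> {1..n} - H" for v
  proof (cases "v \<in> dom ?l")
    case True
    then have "card (seen (neighbors E v) ?l) < q\<^sup>2" using v by (auto simp: H heavy_def)
    moreover have "snapshot ?s v = ?l" using True v by (simp add: merge_def)
    ultimately show ?thesis using consistent_mono[OF K cons] HV by simp
  next
    case False
    then have "snapshot ?s v = snapshot s v" by (auto simp: merge_def)
    then show ?thesis using inv v False consistent_mono[OF K] unfolding invariant_def by auto
  qed
  \<comment> \<open>If both ends were active and one is dropped now, its snapshot is the old
    labelling, which still labels the other end, even if that end is dropped at the same
    time.\<close>
  moreover have "u \<in> H \<and> v \<in> H \<or> v \<notin> H \<and> u \<in> dom (snapshot ?s v) \<or> u \<notin> H \<and> v \<in> dom (snapshot ?s u)"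
    if "{u, v} \<in> E" for u v
  proof -
    have "u \<in> dom ?l \<and> v \<in> dom ?l \<or> v \<notin> dom ?l \<and> u \<in> dom (snapshot s v) \<or> u \<notin> dom ?l \<and> v \<in> dom (snapshot s u)"
      using inv that unfolding invariant_def by blast
    then show ?thesis using HV(1) by (auto simp: merge_def)
  qed
  moreover have "card (ran (labels ?s)) * q ^ Suc t \<le> n * 3 ^ Suc t"
  proof -
    let ?U = "{v \<in> H. rep s H v = v \<and> seen (neighbors E v) ?l \<inter> B = {}}"
    have fin: "finite (ran ?l)" "finite ?U"
      using HV by (auto intro: finite_subset)
    have "ran (labels ?s) \<subseteq> (ran ?l \<inter> B) \<union> (\<lambda>v. the (?l v)) ` ?U"
    proof
      fix a assume "a \<in> ran (labels ?s)"
      then obtain x where x: "x \<in> H" "?l (\<rho> x) = Some a" by (auto simp: ran_def l' split: if_splits)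
      let ?v = "rep s H x"
      note r = rep[OF x(1), of s]
      show "a \<in> (ran ?l \<inter> B) \<union> (\<lambda>v. the (?l v)) ` ?U"
      proof (cases "ptr ?v = 0")
        case True
        then have "?v \<in> ?U" using r ptr0[OF r(1,3)] by simp
        moreover have "a = the (?l ?v)" using x(2) True by (simp add: \<rho>_def)
        ultimately show ?thesis by blast
      next
        case False
        then have "\<exists>b\<in>B. ?l (ptr ?v) = Some b" using ptr r(1) HV by blast
        moreover have "?l (ptr ?v) = Some a" using x(2) False by (simp add: \<rho>_def)
        ultimately show ?thesis by (auto simp: ran_def)
      qed
    qed
    then have "card (ran (labels ?s)) \<le> card ((ran ?l \<inter> B) \<union> (\<lambda>v. the (?l v)) ` ?U)"
      using fin by (intro card_mono) auto
    also have "\<dots> \<le> card (ran ?l \<inter> B) + card ((\<lambda>v. the (?l v)) ` ?U)" by (rule card_Un_le)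
    also have "\<dots> \<le> card (ran ?l \<inter> B) + card ?U" using card_image_le[OF fin(2)] by simp
    finally have "q * card (ran (labels ?s)) \<le> q * (card (ran ?l \<inter> B) + card ?U)" by (rule mult_left_mono) simp
    also have "\<dots> \<le> 3 * card (ran ?l)" by (rule cost)
    finally have "q * card (ran (labels ?s)) * q ^ t \<le> 3 * card (ran ?l) * q ^ t" by (rule mult_right_mono) simp
    also have "\<dots> \<le> 3 * (n * 3 ^ t)" using inv by (simp add: invariant_def)
    finally show ?thesis by (simp add: mult_ac)
  qed
  ultimately show ?thesis using HV unfolding invariant_def dom' by auto
qed

section \<open>Contraction phases\<close>

text \<open>Ten rounds: one to announce which vertices are heavy, eight for the digits of the seed,
  one for the pointers.\<close>

lemma learnable_phase:
  assumes q: "q \<ge> 2" and n: "n < 2 ^ ((q + 1) ^ 3)"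
    and L: "L \<ge> 1" "(q ^ 8 + 1) ^ q \<le> 2 ^ L" "n + 1 \<le> 2 ^ L"
    and f: "learnable n L R f" "\<And>E. simple_graph {1..n} E \<Longrightarrow> invariant n q t E (f E)"
  shows "\<exists>f'. learnable n L (R + 10) f' \<and> (\<forall>E. simple_graph {1..n} E \<longrightarrow> invariant n q (Suc t) E (f' E))"
proof -
  \<comment> \<open>The family depends on \<open>n\<close> and \<open>q\<close> only, so all nodes
    agree on it without communication.\<close>
  obtain S :: "nat \<Rightarrow> nat set" where
    S: "\<And>x. x \<in> {1..n} \<Longrightarrow> card {s. s < q ^ 8 \<and> x \<in> S s} \<le> q ^ 7"
      "\<And>N. N \<subseteq> {1..n} \<Longrightarrow> q\<^sup>2 \<le> card N \<Longrightarrow> card {s. s < q ^ 8 \<and> S s \<inter> N = {}} \<le> 2 * q ^ 7"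
    using ex_hitting_family[OF q n] by blast
  have "card (UNIV :: bool set) \<le> 2 ^ L" using L(1) power_increasing[of 1 L "2::nat"] by simp
  from learnable_step[OF f(1) _ this,
      of "\<lambda>s v N. v \<in> dom (labels s) \<and> q\<^sup>2 \<le> card (seen N (labels s))"]
  have "learnable n L (Suc R) (\<lambda>E. (f E, \<lambda>v. if v \<in> {1..n} then v \<in> dom (labels (f E)) \<and>
      q\<^sup>2 \<le> card (seen (neighbors E v) (labels (f E))) else undefined))" by simp
  then have f1: "learnable n L (Suc R) (\<lambda>E. (f E, heavy q E (f E)))"
  proof (rule learnable_map[where g = "\<lambda>(s, h). (s, {v \<in> {1..n}. h v})"])
    fix E assume "simple_graph {1..n} E"
    then have "dom (labels (f E)) \<subseteq> {1..n}" using f(2) by (simp add: invariant_def)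
    then show "(f E, heavy q E (f E)) = (case (f E, \<lambda>v. if v \<in> {1..n} then v \<in> dom (labels (f E)) \<and>
      q\<^sup>2 \<le> card (seen (neighbors E v) (labels (f E))) else undefined) of (s, h) \<Rightarrow> (s, {v \<in> {1..n}. h v}))"
      by (auto simp: heavy_def)
  qed
  \<comment> \<open>The cost of the class \<open>S x\<close> is the number of labels inside it,
    which is public, plus the number of representatives seeing none of its labels, which each of
    them has to report.\<close>
  define p where "p = (\<lambda>(s :: state, H :: nat set) x. card (ran (labels s) \<inter> S x))"
  define miss where "miss = (\<lambda>(s :: state, H) v N x. v \<in> H \<and> rep s H v = v \<and> seen N (labels s) \<inter> S x = {})"
  have "\<exists>f2. learnable n L (Suc R + 8) f2 \<and> (\<forall>E. simple_graph {1..n} E \<longrightarrow>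
      fst (f2 E) = (f E, heavy q E (f E)) \<and> snd (f2 E) < q ^ 8 \<and>
      q ^ 8 * (p (f E, heavy q E (f E)) (snd (f2 E)) +
        (\<Sum>v\<in>{1..n}. of_bool (miss (f E, heavy q E (f E)) v (neighbors E v) (snd (f2 E)))))
      \<le> (\<Sum>x<q ^ 8. p (f E, heavy q E (f E)) x +
        (\<Sum>v\<in>{1..n}. of_bool (miss (f E, heavy q E (f E)) v (neighbors E v) x))))"
    by (rule learnable_cheap_seed[OF f1 _ L(2), where p = p and c = "\<lambda>a v N x. of_bool (miss a v N x)"])
       (use q in auto)
  then obtain f2 where f2: "learnable n L (Suc R + 8) f2"
    and f2E: "\<And>E. simple_graph {1..n} E \<Longrightarrow> fst (f2 E) = (f E, heavy q E (f E)) \<and> snd (f2 E) < q ^ 8 \<and>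
      q ^ 8 * (p (f E, heavy q E (f E)) (snd (f2 E)) +
        (\<Sum>v\<in>{1..n}. of_bool (miss (f E, heavy q E (f E)) v (neighbors E v) (snd (f2 E)))))
      \<le> (\<Sum>x<q ^ 8. p (f E, heavy q E (f E)) x +
        (\<Sum>v\<in>{1..n}. of_bool (miss (f E, heavy q E (f E)) v (neighbors E v) x)))"
    by blast
  \<comment> \<open>A representative that sees the class points to a neighbour with a label in it;
    all other vertices send 0.\<close>
  define g where "g = (\<lambda>((s :: state, H), x) v N.
    if v \<in> H \<and> rep s H v = v \<and> seen N (labels s) \<inter> S x \<noteq> {} then SOME u. u \<in> N \<and> (\<exists>b\<in>S x. labels s u = Some b) else 0)"
  have g: "g ((s, H), x) v N \<in> N \<and> (\<exists>b\<in>S x. labels s (g ((s, H), x) v N) = Some b)"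
    if "v \<in> H \<and> rep s H v = v \<and> seen N (labels s) \<inter> S x \<noteq> {}" for s H x v N
  proof -
    have "\<exists>u. u \<in> N \<and> (\<exists>b\<in>S x. labels s u = Some b)" using that by (auto simp: seen_def)
    from someI_ex[OF this] show ?thesis using that by (simp add: g_def)
  qed
  have g0: "g ((s, H), x) v N = 0"
    if "\<not> (v \<in> H \<and> rep s H v = v \<and> seen N (labels s) \<inter> S x \<noteq> {})" for s H x v N
    using that unfolding g_def prod.case by (rule if_not_P)
  have gX: "g z v (neighbors E v) \<in> {0..n}" if "simple_graph {1..n} E" for z v E
  proof -
    obtain s H x where z: "z = ((s, H), x)" by (metis prod.collapse)
    show ?thesis using g[of v H s "neighbors E v" x] g0[of v H s "neighbors E v" x] neighbors_subset[OF that, of v]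
      unfolding z by fastforce
  qed
  have f3: "learnable n L (Suc (Suc R + 8))
    (\<lambda>E. (f2 E, \<lambda>v. if v \<in> {1..n} then g (f2 E) v (neighbors E v) else undefined))"
    by (rule learnable_step[OF f2, where X = "{0..n}"]) (use L gX in auto)
  define u where "u = (\<lambda>(((s, H), x :: nat), ptr). merge n s H ptr)"
  let ?f = "\<lambda>E. u (f2 E, \<lambda>v. if v \<in> {1..n} then g (f2 E) v (neighbors E v) else undefined)"
  have "learnable n L (Suc (Suc R + 8)) ?f" by (rule learnable_map[OF f3]) simp
  then have "learnable n L (R + 10) ?f" by (simp add: eval_nat_numeral)
  moreover have "invariant n q (Suc t) E (?f E)" if E: "simple_graph {1..n} E" for E
  proof -
    define s where "s = f E"
    define H where "H = heavy q E s"
    define x where "x = snd (f2 E)"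
    have f2x: "f2 E = ((s, H), x)" using f2E[OF E] unfolding s_def H_def x_def by (metis prod.collapse)
    define ptr where "ptr = (\<lambda>v. if v \<in> {1..n} then g ((s, H), x) v (neighbors E v) else undefined)"
    have inv: "invariant n q t E s" using f(2)[OF E] by (simp add: s_def)
    have HV: "H \<subseteq> {1..n}" "ran (labels s) \<subseteq> {1..n}" "H \<subseteq> dom (labels s)"
      using inv by (auto simp: invariant_def H_def heavy_def)
    have fr: "finite (ran (labels s))" using HV by (auto intro: finite_subset)
    define m where "m = card (ran (labels s))"
    define reps where "reps = {v \<in> H. rep s H v = v}"
    have reps: "reps \<subseteq> {1..n}" "finite reps" using HV by (auto simp: reps_def intro: finite_subset)
    \<comment> \<open>There is at most one representative per label, since \<open>rep\<close>
      depends only on the label.\<close>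
    have "card reps \<le> m"
      unfolding m_def
    proof (rule card_inj_on_le[OF _ _ fr])
      have some: "labels s v \<noteq> None" if "v \<in> reps" for v using that HV(3) by (auto simp: reps_def)
      show "inj_on (\<lambda>v. the (labels s v)) reps"
      proof (rule inj_onI)
        fix v w assume vw: "v \<in> reps" "w \<in> reps" "the (labels s v) = the (labels s w)"
        then have "labels s v = labels s w" using some[OF vw(1)] some[OF vw(2)] by auto
        then show "v = w" using vw rep_cong[of s v w H] by (simp add: reps_def)
      qed
      show "(\<lambda>v. the (labels s v)) ` reps \<subseteq> ran (labels s)" using some by (auto simp: ran_def)
    qed
    let ?N = "\<lambda>v. seen (neighbors E v) (labels s)"
    let ?w = "\<lambda>x. card (ran (labels s) \<inter> S x) + (\<Sum>v\<in>{1..n}. of_bool (v \<in> reps \<and> ?N v \<inter> S x = {}))"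
    have w: "p (s, H) x + (\<Sum>v\<in>{1..n}. of_bool (miss (s, H) v (neighbors E v) x)) = ?w x" for x
      by (simp add: p_def miss_def reps_def conj_assoc)
    have card_sum: "(\<Sum>x<q ^ 8. of_bool (P x)) = card {x. x < q ^ 8 \<and> P x}" for P
      by (simp add: of_bool_def sum.If_cases Int_def lessThan_def)
    \<comment> \<open>Double counting: the labels contribute at most \<open>m * q ^ 7\<close> over
      all classes and the representatives at most \<open>2 * m * q ^ 7\<close>, so the average over
      the \<open>q ^ 8\<close> classes is at most \<open>3 * m / q\<close>.\<close>
    have "(\<Sum>x<q ^ 8. card (ran (labels s) \<inter> S x)) = (\<Sum>x<q ^ 8. \<Sum>a\<in>ran (labels s). of_bool (a \<in> S x))"
      using fr by (simp add: of_bool_def sum.If_cases)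
    also have "\<dots> = (\<Sum>a\<in>ran (labels s). \<Sum>x<q ^ 8. of_bool (a \<in> S x))" by (rule sum.swap)
    also have "\<dots> \<le> (\<Sum>a\<in>ran (labels s). q ^ 7)"
      unfolding card_sum using HV(2) by (intro sum_mono S(1)) auto
    finally have 1: "(\<Sum>x<q ^ 8. card (ran (labels s) \<inter> S x)) \<le> m * q ^ 7" by (simp add: m_def)
    have "(\<Sum>x<q ^ 8. \<Sum>v\<in>{1..n}. of_bool (v \<in> reps \<and> ?N v \<inter> S x = {})) =
        (\<Sum>v\<in>{1..n}. \<Sum>x<q ^ 8. of_bool (v \<in> reps \<and> ?N v \<inter> S x = {}))" by (rule sum.swap)
    also have "\<dots> \<le> (\<Sum>v\<in>{1..n}. if v \<in> reps then 2 * q ^ 7 else 0)"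
    proof (rule sum_mono)
      fix v
      show "(\<Sum>x<q ^ 8. of_bool (v \<in> reps \<and> ?N v \<inter> S x = {})) \<le> (if v \<in> reps then 2 * q ^ 7 else 0)"
      proof (cases "v \<in> reps")
        case True
        \<comment> \<open>Labels are vertex numbers, so the hitting property applies to the set of
          labels seen by \<open>v\<close>.\<close>
        then have "q\<^sup>2 \<le> card (?N v)" by (auto simp: reps_def H_def heavy_def)
        then show ?thesis
          using S(2)[OF seen_subset[OF HV(2)], of "neighbors E v"] True by (simp add: card_sum Int_commute)
      qed simp
    qed
    also have "\<dots> = card reps * (2 * q ^ 7)"
      using reps by (simp add: sum.If_cases Int_absorb1)
    also have "\<dots> \<le> m * (2 * q ^ 7)" using \<open>card reps \<le> m\<close> by (rule mult_right_mono) simp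
    finally have "(\<Sum>x<q ^ 8. ?w x) \<le> 3 * m * q ^ 7" using 1 by (simp add: sum.distrib)
    moreover have "q ^ 8 * ?w x \<le> (\<Sum>x<q ^ 8. ?w x)"
      using f2E[OF E] unfolding s_def[symmetric] H_def[symmetric] x_def[symmetric] w by blast
    ultimately have "q ^ 8 * ?w x \<le> 3 * m * q ^ 7" by linarith
    moreover have "q ^ 8 = q ^ 7 * q" by (simp flip: power_Suc2)
    ultimately have "q ^ 7 * (q * ?w x) \<le> q ^ 7 * (3 * m)"
      by (simp only: mult_ac)
    then have qw: "q * ?w x \<le> 3 * m" using q by simp
    have "(\<Sum>v\<in>{1..n}. of_bool (v \<in> reps \<and> ?N v \<inter> S x = {})) = card {v \<in> H. rep s H v = v \<and> ?N v \<inter> S x = {}}"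
      using HV(1) by (auto simp: of_bool_def sum.If_cases reps_def intro!: arg_cong[where f = card])
    then have cost: "q * (card (ran (labels s) \<inter> S x) + card {v \<in> H. rep s H v = v \<and> ?N v \<inter> S x = {}})
        \<le> 3 * card (ran (labels s))" using qw by (simp add: m_def)
    have "invariant n q (Suc t) E (merge n s H ptr)"
    proof (rule invariant_merge[OF E inv H_def _ _ cost])
      fix v assume "v \<in> {1..n}" "ptr v \<noteq> 0"
      then show "ptr v \<in> neighbors E v \<and> (\<exists>b\<in>S x. labels s (ptr v) = Some b)"
        using g[of v H s "neighbors E v" x] g0[of v H s "neighbors E v" x] unfolding ptr_def by (auto split: if_splits)
    next
      fix v assume v: "v \<in> H" "rep s H v = v" "ptr v = 0"
      then have "0 \<notin> neighbors E v" "ptr v = g ((s, H), x) v (neighbors E v)"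
        using neighbors_subset[OF E, of v] subsetD[OF HV(1) v(1)] by (auto simp: ptr_def)
      then show "?N v \<inter> S x = {}" using g[of v H s "neighbors E v" x] v by metis
    qed
    moreover have "?f E = merge n s H ptr" unfolding u_def f2x ptr_def prod.case by (rule refl)
    ultimately show ?thesis by (simp only:)
  qed
  ultimately show ?thesis by (intro exI[of _ ?f]) blast
qed

lemma learnable_phases:
  assumes "q \<ge> 2" "n < 2 ^ ((q + 1) ^ 3)" "L \<ge> 1" "(q ^ 8 + 1) ^ q \<le> 2 ^ L" "n + 1 \<le> 2 ^ L"
  shows "\<exists>f. learnable n L (10 * t) f \<and> (\<forall>E. simple_graph {1..n} E \<longrightarrow> invariant n q t E (f E))"
proof (induction t)
  case 0
  \<comment> \<open>Initially every vertex is active under its own number, which takes no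
    round.\<close>
  define l where "l v = (if v \<in> {1..n} then Some v else None)" for v
  define s where "s = \<lparr>labels = l, snapshot = undefined, known = {}\<rparr>"
  have some: "l v = Some a \<longleftrightarrow> v \<in> {1..n} \<and> a = v" for v a by (cases "v \<in> {1..n}") (auto simp: l_def simp del: atLeastAtMost_iff)
  have l: "dom l = {1..n}" "ran l = {1..n}" by (simp_all add: dom_def ran_def some del: atLeastAtMost_iff One_nat_def)
  have "x = y" if "x \<in> dom l" "l x = l y" for x y using that some by (metis domD)
  then have "consistent {} l" unfolding consistent_def using conn_refl by metis
  then have "invariant n q 0 E s" if "simple_graph {1..n} E" for E
    using edge_subset[OF that] by (simp add: invariant_def s_def l del: One_nat_def)
  then show ?case using learnable_const[of n L s] by (intro exI[of _ "\<lambda>_. s"]) simp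
next
  case (Suc t)
  then obtain f where f: "learnable n L (10 * t) f"
    "\<And>E. simple_graph {1..n} E \<Longrightarrow> invariant n q t E (f E)" by blast
  show ?case using learnable_phase[OF assms f] by (simp add: add.commute)
qed

section \<open>Announcing the output edges, and small \<open>n\<close>\<close>

text \<open>By \<open>t\<close> fewer than one label is left, so every vertex has been dropped and
  names one neighbour for each of the fewer than \<open>q\<^sup>2\<close> labels seen in its
  snapshot. If \<open>v\<close> has a neighbour \<open>u\<close> labelled there, the neighbour named
  for the label of \<open>u\<close> is connected to \<open>u\<close> by known edges, as the snapshot
  is consistent.\<close>

lemma learnable_spanning_edges:
  assumes L: "n + 1 \<le> 2 ^ L"
    and f: "learnable n L R f" "\<And>E. simple_graph {1..n} E \<Longrightarrow> invariant n q t E (f E)"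
    and t: "n * 3 ^ t < q ^ t"
  shows "\<exists>F. learnable n L (R + q\<^sup>2) F \<and> (\<forall>E. simple_graph {1..n} E \<longrightarrow>
    F E \<subseteq> E \<and> components {1..n} (F E) = components {1..n} E)"
proof -
  define pick where "pick = (\<lambda>(s :: state) v N a. SOME u. u \<in> N \<and> snapshot s v u = Some (a :: nat))"
  define xs where "xs = (\<lambda>(s :: state) v N. map (pick s v N) (sorted_list_of_set (seen N (snapshot s v))))"
  \<comment> \<open>Round \<open>i\<close> serves the label at position \<open>i\<close> of the
    increasing list; 0 means that nothing is announced. Testing membership in \<open>N\<close>
    ensures that every announced pair is an edge.\<close>
  define g where "g = (\<lambda>(s :: state) v N i. if i < length (xs s v N) \<and> xs s v N ! i \<in> N then xs s v N ! i else 0)"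
  have pick: "pick s v N a \<in> N \<and> snapshot s v (pick s v N a) = Some a" if "a \<in> seen N (snapshot s v)" for s v N a
    unfolding pick_def by (rule someI_ex) (use that in \<open>auto simp: seen_def\<close>)
  have gX: "g s v (neighbors E v) i \<in> {0..n}" if "simple_graph {1..n} E" for s v i E
    using neighbors_subset[OF that, of v] by (auto simp: g_def)
  have *: "learnable n L (R + q\<^sup>2)
    (\<lambda>E. (f E, \<lambda>v i. if v \<in> {1..n} \<and> i < q\<^sup>2 then g (f E) v (neighbors E v) i else undefined))"
    by (rule learnable_steps[OF f(1), where X = "{0..n}"]) (use L gX in auto)
  let ?U = "\<lambda>s h. known s \<union> (\<Union>v\<in>{1..n}. \<Union>i<q\<^sup>2. if h v i = 0 then {} else {{v, h v i}})"
  let ?F = "\<lambda>E. ?U (f E) (\<lambda>v. g (f E) v (neighbors E v))"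
  have F: "learnable n L (R + q\<^sup>2) ?F"
    by (rule learnable_map[OF *, where g = "\<lambda>(s, h). ?U s h"])
      (unfold prod.case, intro arg_cong2[where f = "(\<union>)"] SUP_cong refl, simp)
  have FE: "?F E \<subseteq> E \<and> components {1..n} (?F E) = components {1..n} E" if E: "simple_graph {1..n} E" for E
  proof
    let ?s = "f E"
    note inv = f(2)[OF E]
    have fr: "finite (ran (labels ?s))" using inv by (auto simp: invariant_def intro: finite_subset)
    have "card (ran (labels ?s)) * q ^ t < 1 * q ^ t"
      using inv t unfolding invariant_def by linarith
    then have "card (ran (labels ?s)) = 0" by (simp only: mult_less_cancel2) simp
    then have "ran (labels ?s) = {}" using fr by simp
    then have dom0: "dom (labels ?s) = {}" by (metis domD equals0D equals0I ranI)
    have edge: "{v, g ?s v (neighbors E v) i} \<in> E" if "g ?s v (neighbors E v) i \<noteq> 0" for v i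
      using that by (auto simp: g_def neighbors_def insert_commute split: if_splits)
    then show FE: "?F E \<subseteq> E" using inv by (auto simp: invariant_def split: if_splits)
    have main: "(v, u) \<in> conn (?F E)" if uv: "{u, v} \<in> E" and u: "u \<in> dom (snapshot ?s v)" for u v
    proof -
      have v: "v \<in> {1..n}" using edge_subset[OF E uv] by simp
      obtain a where a: "snapshot ?s v u = Some a" using u by blast
      let ?N = "neighbors E v" and ?sn = "seen (neighbors E v) (snapshot ?s v)"
      have as: "a \<in> ?sn" using a uv by (auto simp: seen_def neighbors_def)
      have sn: "ran (snapshot ?s v) \<subseteq> {1..n}" "card ?sn < q\<^sup>2" "consistent (known ?s) (snapshot ?s v)"
        using inv v dom0 by (auto simp: invariant_def)
      have "finite ?sn" using seen_subset[OF sn(1)] by (rule finite_subset) simp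
      then obtain i where i: "i < card ?sn" "sorted_list_of_set ?sn ! i = a"
        using as by (metis in_set_conv_nth length_sorted_list_of_set set_sorted_list_of_set)
      let ?u = "pick ?s v ?N a"
      have uN: "?u \<in> ?N" "snapshot ?s v ?u = Some a" using pick[OF as] by auto
      have "g ?s v ?N i = ?u" using i uN by (simp add: g_def xs_def)
      moreover have "?u \<noteq> 0" using uN neighbors_subset[OF E, of v] by (metis atLeastAtMost_iff not_one_le_zero subsetD)
      moreover have "i < q\<^sup>2" using i(1) sn(2) by (rule less_trans)
      ultimately have "{v, ?u} \<in> ?F E" using v by force
      then have 1: "(v, ?u) \<in> conn (?F E)" by (rule conn_edge)
      have "(?u, u) \<in> conn (known ?s)" using sn(3) uN(2) a by (force simp: consistent_def)
      then have "(?u, u) \<in> conn (?F E)" using conn_mono[of "known ?s" "?F E"] by blast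
      then show ?thesis using 1 conn_trans by blast
    qed
    show "components {1..n} (?F E) = components {1..n} E"
    proof (rule components_eqI[OF FE])
      fix u v assume uv: "{u, v} \<in> E"
      then have "u \<in> dom (snapshot ?s v) \<or> v \<in> dom (snapshot ?s u)"
        using inv unfolding invariant_def dom0 by blast
      then show "(u, v) \<in> conn (?F E)"
      proof
        assume "u \<in> dom (snapshot ?s v)"
        from main[OF uv this] show ?thesis by (rule conn_sym)
      next
        assume "v \<in> dom (snapshot ?s u)"
        with uv show ?thesis by (intro main) (simp_all only: insert_commute)
      qed
    qed
  qed
  show ?thesis by (rule exI[of _ ?F], rule conjI, rule F, intro allI impI, rule FE)
qed

text \<open>For \<open>cube_log n < 9\<close> every node sends its whole neighbourhood in one round.
  Such messages have \<open>n\<close> bits, but only finitely many \<open>n\<close> are treated this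
  way.\<close>

lemma learnable_graph:
  "\<exists>F. learnable n n 1 F \<and> (\<forall>E. simple_graph {1..n} E \<longrightarrow> F E = E)"
proof -
  have "learnable n n (Suc 0) (\<lambda>E. ((), \<lambda>v. if v \<in> {1..n} then neighbors E v else undefined))"
    by (rule learnable_step[OF learnable_const, where X = "Pow {1..n}"])
       (use neighbors_subset in \<open>auto simp: card_Pow simp del: One_nat_def\<close>)
  then have "learnable n n (Suc 0) (\<lambda>E. \<Union>v\<in>{1..n}. (\<lambda>u. {v, u}) ` neighbors E v)"
    by (rule learnable_map[where g = "\<lambda>(x, h). \<Union>v\<in>{1..n}. (\<lambda>u. {v, u}) ` h v"]) simp
  moreover have "(\<Union>v\<in>{1..n}. (\<lambda>u. {v, u}) ` neighbors E v) = E" if E: "simple_graph {1..n} E" for E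
  proof
    show "E \<subseteq> (\<Union>v\<in>{1..n}. (\<lambda>u. {v, u}) ` neighbors E v)"
    proof
      fix e assume e: "e \<in> E"
      then obtain v u where "e = {v, u}" "e \<subseteq> {1..n}" using E by (auto simp: simple_graph_def card_2_iff)
      then show "e \<in> (\<Union>v\<in>{1..n}. (\<lambda>u. {v, u}) ` neighbors E v)"
        using e by (auto simp: neighbors_def insert_commute)
    qed
  qed (auto simp: neighbors_def insert_commute)
  ultimately show ?thesis unfolding One_nat_def by blast
qed

section \<open>Asymptotics\<close>

text \<open>For \<open>n \<ge> 1\<close> this is the integer part of the cube root of
  \<open>log 2 n\<close>. The third power leaves room for vectors of \<open>q\<close> counts of
  \<open>O(log q)\<close> bits in one message and keeps the final \<open>q\<^sup>2\<close> rounds of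
  lower order.\<close>

definition cube_log :: "nat \<Rightarrow> nat" where
  "cube_log n = (LEAST q. n < 2 ^ ((q + 1) ^ 3))"

lemma less_cube_log: "n < 2 ^ ((cube_log n + 1) ^ 3)"
proof -
  have "n < 2 ^ n" by (rule less_exp)
  also have "n \<le> (n + 1) ^ 3" using self_le_power[of "n + 1" 3] by simp
  then have "(2 :: nat) ^ n \<le> 2 ^ ((n + 1) ^ 3)" by (rule power_increasing) simp
  finally show ?thesis unfolding cube_log_def by (rule LeastI)
qed

lemma cube_log_le:
  assumes "cube_log n > 0"
  shows "2 ^ (cube_log n ^ 3) \<le> n"
proof -
  have "\<not> n < 2 ^ ((cube_log n - 1 + 1) ^ 3)"
    by (rule not_less_Least[of _ "\<lambda>q. n < 2 ^ ((q + 1) ^ 3)", folded cube_log_def]) (use assms in simp)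
  then show ?thesis using assms by simp
qed

lemma cube_log_ge: "eventually (\<lambda>n. cube_log n \<ge> q) at_top"
proof (rule eventually_sequentiallyI)
  fix n :: nat
  assume n: "2 ^ (q ^ 3) \<le> n"
  show "q \<le> cube_log n"
  proof (rule ccontr)
    assume "\<not> q \<le> cube_log n"
    then have "(cube_log n + 1) ^ 3 \<le> q ^ 3" by (intro power_mono) auto
    then have "(2 :: nat) ^ ((cube_log n + 1) ^ 3) \<le> 2 ^ (q ^ 3)" by (rule power_increasing) simp
    then show False using less_cube_log[of n] n by linarith
  qed
qed

text \<open>For \<open>q \<ge> 9\<close> the ceiling \<open>c\<close> satisfies
  \<open>q ^ c \<ge> 2 ^ ((q + 1) ^ 3)\<close>, which exceeds \<open>n\<close>. The factor 2
  provides a second \<open>q ^ c\<close>, which pays for \<open>3 ^ (2 * c) = 9 ^ c\<close>; this is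
  where the threshold 9 comes from.\<close>

definition phases :: "nat \<Rightarrow> nat" where
  "phases q = 2 * nat \<lceil>real (q + 1) ^ 3 / log 2 (real q)\<rceil>"

definition round_bound :: "nat \<Rightarrow> nat" where
  "round_bound n = (let q = cube_log n in if q < 9 then 1 else 10 * phases q + q\<^sup>2)"

definition message_bound :: "nat \<Rightarrow> nat" where
  "message_bound n = (let q = cube_log n in if q < 9 then n else 9 * (q + 1) ^ 3)"

lemma phases_suffice:
  assumes q: "q \<ge> 9" and n: "n < 2 ^ ((q + 1) ^ 3)"
  shows "n * 3 ^ phases q < q ^ phases q"
proof -
  define k where "k = (q + 1) ^ 3"
  define c where "c = nat \<lceil>real (q + 1) ^ 3 / log 2 (real q)\<rceil>"
  have phases: "phases q = 2 * c" by (simp only: phases_def c_def)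
  have lq: "log 2 (real q) > 0" using q by simp
  have "real (q + 1) ^ 3 / log 2 (real q) \<le> c" unfolding c_def by linarith
  then have "real (q + 1) ^ 3 \<le> c * log 2 (real q)" using lq by (simp add: field_simps)
  also have "\<dots> = log 2 (real q ^ c)" using q by (simp add: log_nat_power)
  finally have "real k \<le> log 2 (real q ^ c)" by (simp add: k_def)
  then have "2 powr real k \<le> real q ^ c" using q by (simp add: le_log_iff)
  then have "real (2 ^ k) \<le> real (q ^ c)" by (simp add: powr_realpow)
  then have "n < q ^ c" using n unfolding k_def[symmetric] by linarith
  then have "n * 3 ^ phases q < q ^ c * 3 ^ phases q" by simp
  also have "\<dots> = (q * 9) ^ c"
    by (simp add: phases power_mult_distrib power_mult)
  also have "\<dots> \<le> (q * q) ^ c" using q by (intro power_mono) auto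
  also have "\<dots> = q ^ phases q"
    by (simp add: phases power_mult power2_eq_square)
  finally show ?thesis .
qed

lemma learnable_components:
  "\<exists>F. learnable n (message_bound n) (round_bound n) F \<and> (\<forall>E. simple_graph {1..n} E \<longrightarrow>
    F E \<subseteq> E \<and> components {1..n} (F E) = components {1..n} E)"
proof (cases "cube_log n < 9")
  case True
  then have "message_bound n = n" "round_bound n = 1" by (simp_all add: message_bound_def round_bound_def)
  then show ?thesis using learnable_graph[of n] by (metis order_refl)
next
  case False
  define q where "q = cube_log n"
  define L where "L = 9 * (q + 1) ^ 3"
  have q: "q \<ge> 9" using False by (simp add: q_def)
  have eq: "message_bound n = L" "round_bound n = 10 * phases q + q\<^sup>2"
    using q by (simp_all add: message_bound_def round_bound_def q_def[symmetric] L_def)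
  have n: "n < 2 ^ ((q + 1) ^ 3)" unfolding q_def by (rule less_cube_log)
  have "(2 :: nat) ^ ((q + 1) ^ 3) \<le> 2 ^ L" unfolding L_def by (rule power_increasing) auto
  then have L1: "n + 1 \<le> 2 ^ L" using n by linarith
  \<comment> \<open>A count takes at most \<open>9 * q\<close> bits, so a cost vector of
    \<open>q\<close> counts takes at most \<open>9 * q\<^sup>2\<close>.\<close>
  have "q ^ 8 + 1 \<le> q ^ 8 * 2" using q by simp
  also have "\<dots> \<le> q ^ 8 * q" using q by (intro mult_left_mono) auto
  also have "\<dots> = q ^ 9" by (simp flip: power_Suc2)
  also have "\<dots> \<le> (2 ^ q) ^ 9" using less_exp[of q] by (intro power_mono) auto
  finally have "(q ^ 8 + 1) ^ q \<le> ((2 ^ q) ^ 9) ^ q" by (rule power_mono) simp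
  also have "\<dots> = 2 ^ (9 * q\<^sup>2)" by (simp add: power2_eq_square mult_ac flip: power_mult)
  also have "\<dots> \<le> 2 ^ L"
  proof (rule power_increasing)
    have "q\<^sup>2 \<le> (q + 1)\<^sup>2" by (intro power_mono) auto
    also have "\<dots> \<le> (q + 1) ^ 3" by (rule power_increasing) auto
    finally show "9 * q\<^sup>2 \<le> L" by (simp add: L_def)
  qed simp
  finally have L2: "(q ^ 8 + 1) ^ q \<le> 2 ^ L" .
  have "L \<ge> 1" by (simp add: L_def)
  then obtain f where "learnable n L (10 * phases q) f"
    "\<And>E. simple_graph {1..n} E \<Longrightarrow> invariant n q (phases q) E (f E)"
    using learnable_phases[OF _ n _ L2 L1, of "phases q"] q by auto
  then show ?thesis unfolding eq using learnable_spanning_edges[OF L1 _ _ phases_suffice[OF q n]] by blast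
qed

lemma message_bound_bigo: "(\<lambda>n. real (message_bound n)) \<in> O(\<lambda>n. log 2 (real n))"
\<comment> \<open>The constant is \<open>9 * 2 ^ 3\<close>, from
  \<open>q + 1 \<le> 2 * q\<close>.\<close>
proof (rule bigoI[of _ 72])
  show "eventually (\<lambda>n. norm (real (message_bound n)) \<le> 72 * norm (log 2 (real n))) at_top"
    using cube_log_ge[of 9]
  proof eventually_elim
    case (elim n)
    define q where "q = cube_log n"
    have q: "q \<ge> 9" using elim by (simp add: q_def)
    have "2 ^ (q ^ 3) \<le> n" using cube_log_le[of n] q by (simp add: q_def)
    then have "real (2 ^ (q ^ 3)) \<le> real n" by (rule of_nat_mono)
    then have x: "real (q ^ 3) \<le> log 2 (real n)"
      using le_log_of_power[of 2 "q ^ 3" "real n"] by simp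
    have "(q + 1) ^ 3 \<le> (2 * q) ^ 3" using q by (intro power_mono) auto
    then have "message_bound n \<le> 72 * q ^ 3"
      using q by (simp add: message_bound_def q_def[symmetric] power_mult_distrib)
    then have "real (message_bound n) \<le> 72 * real (q ^ 3)" by linarith
    then show ?case using x by simp
  qed
qed

lemma round_bound_bigo:
  "(\<lambda>n. real (round_bound n)) \<in> O(\<lambda>n. log 2 (real n) / log 2 (log 2 (real n)))"
\<comment> \<open>The constant is \<open>6 * 181\<close>. With \<open>y\<close> as below,
  \<open>10 * (2 * (8 * y + 1)) + y \<le> 181 * y\<close> because \<open>y \<ge> 1\<close>; the 6
  comes from \<open>log 2 (log 2 n) \<le> 6 * log 2 q\<close>.\<close>
proof (rule bigoI[of _ 1086])
  show "eventually (\<lambda>n. norm (real (round_bound n)) \<le> 1086 * norm (log 2 (real n) / log 2 (log 2 (real n)))) at_top"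
    using cube_log_ge[of 9]
  proof eventually_elim
    case (elim n)
    define q where "q = cube_log n"
    define x where "x = log 2 (real n)"
    define l where "l = log 2 (real q)"
    have q: "q \<ge> 9" using elim by (simp add: q_def)
    have n2: "2 ^ (q ^ 3) \<le> n" using cube_log_le[of n] q by (simp add: q_def)
    then have "real (2 ^ (q ^ 3)) \<le> real n" by (rule of_nat_mono)
    then have x: "real q ^ 3 \<le> x"
      using le_log_of_power[of 2 "q ^ 3" "real n"] by (simp add: x_def)
    have "(2 :: nat) ^ (q ^ 3) > 0" by simp
    then have n0: "n > 0" using n2 by linarith
    have "real n < real (2 ^ ((q + 1) ^ 3))"
      using less_cube_log[of n] by (simp only: of_nat_less_iff q_def)
    then have "real n < 2 ^ ((q + 1) ^ 3)" by simp
    then have "x < real ((q + 1) ^ 3)"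
      unfolding x_def by (rule log_of_power_less) (use n0 in auto)
    also have "\<dots> = real (q + 1) ^ 3" by simp
    \<comment> \<open>A crude bound is enough: any fixed power of \<open>q\<close> gives
      \<open>log 2 x = O(l)\<close>.\<close>
    also have "\<dots> \<le> (real q ^ 2) ^ 3"
    proof (rule power_mono)
      have "real (q + 1) \<le> 2 * real q" using q by simp
      also have "\<dots> \<le> real q ^ 2" using q by (simp add: power2_eq_square)
      finally show "real (q + 1) \<le> real q ^ 2" .
    qed simp
    also have "\<dots> = real q ^ 6" by (simp flip: power_mult)
    finally have "log 2 x \<le> log 2 (real q ^ 6)" using x q by (intro log_mono) (auto intro: less_le_trans[of 0 "real q ^ 3"])
    then have lx: "log 2 x \<le> 6 * l" using q by (simp add: l_def log_nat_power)
    have "1 < real q ^ 3" using q by (intro one_less_power) auto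
    then have lx0: "log 2 x > 0" "x > 1" using x by auto
    have l0: "l > 0" using q by (simp add: l_def)
    have "l \<le> log 2 (2 ^ q)" unfolding l_def using q less_exp[of q]
      by (intro log_mono) (auto simp: less_imp_le of_nat_less_numeral_power_cancel_iff)
    then have lq: "l \<le> q" by (simp add: log_nat_power)
    \<comment> \<open>The order of the number of phases; it also dominates the final
      \<open>q\<^sup>2\<close> rounds, since \<open>l \<le> q\<close>.\<close>
    define y where "y = real q ^ 3 / l"
    have "real q ^ 2 = real q ^ 3 / q" using q by (simp add: power2_eq_square power3_eq_cube)
    also have "\<dots> \<le> y" unfolding y_def using lq l0 by (intro divide_left_mono) auto
    finally have y: "real q ^ 2 \<le> y" .
    have "1 \<le> real q ^ 2" using q by (intro one_le_power) auto
    then have y1: "1 \<le> y" using y by linarith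
    have "real (q + 1) ^ 3 \<le> (2 * real q) ^ 3" using q by (intro power_mono) auto
    then have "real (q + 1) ^ 3 / l \<le> 8 * y"
      using l0 by (simp add: y_def power_mult_distrib divide_right_mono)
    moreover have "real (nat \<lceil>real (q + 1) ^ 3 / l\<rceil>) \<le> real (q + 1) ^ 3 / l + 1"
    proof -
      have "0 \<le> real (q + 1) ^ 3 / l" using l0 by simp
      then have "real (nat \<lceil>real (q + 1) ^ 3 / l\<rceil>) = of_int \<lceil>real (q + 1) ^ 3 / l\<rceil>" by simp
      then show ?thesis by linarith
    qed
    ultimately have "real (nat \<lceil>real (q + 1) ^ 3 / l\<rceil>) \<le> 8 * y + 1" by linarith
    then have "real (phases q) \<le> 2 * (8 * y + 1)"
      unfolding phases_def l_def[symmetric] of_nat_mult by simp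
    then have "real (round_bound n) \<le> 181 * y"
      using q y y1 by (simp add: round_bound_def q_def[symmetric])
    also have "\<dots> \<le> 181 * (6 * (x / log 2 x))"
    proof -
      have "real q ^ 3 / (6 * l) \<le> x / log 2 x"
        using x lx lx0 by (intro frac_le) auto
      then show ?thesis by (simp add: y_def)
    qed
    finally show ?case using lx0 by (simp add: x_def)
  qed
qed

theorem corollary2:
  "\<exists>A :: bcc_algorithm.
     logarithmic_messages A \<and>
     solves_connected_components A \<and>
     (\<lambda>n. real (rounds A n)) \<in> O(\<lambda>n. log 2 (real n) / log 2 (log 2 (real n)))"
proof -
  \<comment> \<open>Choice combines the protocols for the different \<open>n\<close>. As
    \<open>dec\<close> reads only the transcript, all nodes output the same edge set.\<close>
  have "\<exists>bc dec. \<forall>E. simple_graph {1..n} E \<longrightarrow>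
      (\<forall>ms \<in> set (transcript_of bc n E (round_bound n)). \<forall>m \<in> set ms. length m \<le> message_bound n) \<and>
      dec (transcript_of bc n E (round_bound n)) \<subseteq> E \<and>
      components {1..n} (dec (transcript_of bc n E (round_bound n))) = components {1..n} E" for n
    using learnable_components[of n] unfolding learnable_def by metis
  then obtain bc dec where *: "\<And>n E. simple_graph {1..n} E \<Longrightarrow>
      (\<forall>ms \<in> set (transcript_of (bc n) n E (round_bound n)). \<forall>m \<in> set ms. length m \<le> message_bound n) \<and>
      dec n (transcript_of (bc n) n E (round_bound n)) \<subseteq> E \<and>
      components {1..n} (dec n (transcript_of (bc n) n E (round_bound n))) = components {1..n} E"
    by metis
  define A where "A = \<lparr>rounds = round_bound, broadcast = bc, result = (\<lambda>n v N tr. dec n tr)\<rparr>"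
  have tr: "final_transcript A n E = transcript_of (bc n) n E (round_bound n)" for n E
    by (simp add: final_transcript_def run_eq_transcript_of A_def)
  have "logarithmic_messages A"
    unfolding logarithmic_messages_def tr using message_bound_bigo * by blast
  moreover have "solves_connected_components A"
    unfolding solves_connected_components_def tr
  proof (intro allI impI)
    fix n E assume E: "simple_graph {1..n} E"
    show "\<exists>F\<subseteq>E. components {1..n} F = components {1..n} E \<and>
      (\<forall>v\<in>{1..n}. result A n v (neighbors E v) (transcript_of (bc n) n E (round_bound n)) = F)"
      by (intro exI[of _ "dec n (transcript_of (bc n) n E (round_bound n))"])
        (use *[OF E] in \<open>simp add: A_def\<close>)
  qed
  moreover have "(\<lambda>n. real (rounds A n)) \<in> O(\<lambda>n. log 2 (real n) / log 2 (log 2 (real n)))"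
    using round_bound_bigo by (simp add: A_def)
  ultimately show ?thesis by blast
qed

end
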